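(* Let $n\in\mathbb{N}=\{1,2,\ldots\}$, let $(C_N)_{N\in\mathbb{N}}$ be a sequence of positive real numbers, and let $$K=\bigcup_{N=1}^\infty 2^{N-1}\,b\mathbb{D}^{2n}_{(x,y)}\times C_N\overline{\mathbb{D}}_z\subset\mathbb{C}^{2n+1}.$$ If $C_N\ge n2^{3N+1}$ holds for all $N\in\mathbb{N}$, then the domain $\Omega_0=\mathbb{C}^{2n+1}\setminus K$ is $\alpha_0$-hyperbolic, where $\alpha_0=dz+\sum_{j=1}^n x_j\,dy_j$.
   Context: Coordinates on $\mathbb{C}^{2n+1}$ are $(x,y,z)=(x_1,y_1,\ldots,x_n,y_n,z)$, and $\alpha_0=dz+\sum_{j=1}^n x_j\,dy_j$ is the standard complex contact form. Let $\mathbb{D}=\{\zeta\in\mathbb{C}:|\zeta|<1\}$ and $\overline{\mathbb{D}}=\{\zeta\in\mathbb{C}:|\zeta|\le 1\}$. Here $b\mathbb{D}^{2n}_{(x,y)}\subset\mathbb{C}^{2n}$ is the (topological) boundary of the unit polydisk in the $(x,y)$-space, $\overline{\mathbb{D}}_z$ is the closed unit disk in the $z$-direction, and $tA=\{ta:a\in A\}$ for $t>0$. For a complex manifold $M$ and a holomorphic vector subbundle $\xi\subset TM$, a holomorphic disk $f\colon\mathbb{D}\to M$ is horizontal if $f'(\zeta)\in\xi|_{f(\zeta)}$ for all $\zeta\in\mathbb{D}$. For $p\in M$ and $v\in\xi_p$ set $$|v|_\xi=\inf\left\{\frac{1}{|\lambda|}:\ \exists f\colon\mathbb{D}\to M \text{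 holomorphic and horizontal},\ f(0)=p,\ f'(0)=\lambda v\right\},$$ where $\lambda$ ranges over nonzero complex numbers, and $$d_\xi(p,q)=\inf_\gamma\int_0^1|\gamma'(t)|_\xi\,dt,\qquad p,q\in M,$$ where the infimum is over all piecewise smooth paths $\gamma\colon[0,1]\to M$ satisfying $\gamma(0)=p$, $\gamma(1)=q$ and $\gamma'(t)\in\xi_{\gamma(t)}$ for all $t\in[0,1]$. The directed manifold $(M,\xi)$ is (Kobayashi) hyperbolic if $d_\xi(p,q)>0$ for all pairs of distinct points $p,q\in M$. A domain $\Omega\subset\mathbb{C}^{2n+1}$ is called $\alpha_0$-hyperbolic if $(\Omega,\ker\alpha_0|_\Omega)$ is hyperbolic in this sense. *)

theory Defs
  imports "HOL-Analysis.Analysis"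
begin

section \<open>Kobayashi hyperbolicity of directed domains\<close>

text \<open>A directed manifold is given here by a set \<open>M\<close> in the complex coordinate space
  \<open>complex ^ 'm\<close> and a field \<open>\<xi>\<close> of subspaces of the tangent spaces, each of which is
  identified with \<open>complex ^ 'm\<close>.\<close>

definition disk_deriv :: "(complex \<Rightarrow> complex ^ 'm) \<Rightarrow> complex \<Rightarrow> complex ^ 'm" where
  "disk_deriv f \<zeta> = (\<chi> i. deriv (\<lambda>w. f w $ i) \<zeta>)"

definition horizontal_disk ::
    "(complex ^ 'm) set \<Rightarrow> (complex ^ 'm \<Rightarrow> (complex ^ 'm) set) \<Rightarrow> (complex \<Rightarrow> complex ^ 'm) \<Rightarrow> bool" where
  "horizontal_disk M \<xi> f \<longleftrightarrow>
     (\<forall>i. (\<lambda>\<zeta>. f \<zeta> $ i) holomorphic_on ball 0 1) \<and>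
     (\<forall>\<zeta>\<in>ball 0 1. f \<zeta> \<in> M \<and> disk_deriv f \<zeta> \<in> \<xi> (f \<zeta>))"

definition kobayashi_norm ::
    "(complex ^ 'm) set \<Rightarrow> (complex ^ 'm \<Rightarrow> (complex ^ 'm) set) \<Rightarrow> complex ^ 'm \<Rightarrow> complex ^ 'm \<Rightarrow> ennreal" where
  "kobayashi_norm M \<xi> p v =
     Inf {ennreal (1 / norm c) | c. c \<noteq> 0 \<and>
       (\<exists>f. horizontal_disk M \<xi> f \<and> f 0 = p \<and> disk_deriv f 0 = c *s v)}"

text \<open>Smooth means \<open>C\<^sup>\<infinity>\<close>, with one-sided derivatives at the end points:
  \<open>D k\<close> is the derivative of order \<open>k\<close>.\<close>

definition smooth_on_interval :: "real \<Rightarrow> real \<Rightarrow> (real \<Rightarrow> 'a::real_normed_vector) \<Rightarrow> bool" where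
  "smooth_on_interval a b \<gamma> \<longleftrightarrow>
     (\<exists>D. (\<forall>t\<in>{a..b}. D (0::nat) t = \<gamma> t) \<and>
          (\<forall>k. \<forall>t\<in>{a..b}. (D k has_vector_derivative D (Suc k) t) (at t within {a..b})))"

definition piecewise_smooth_path :: "(real \<Rightarrow> 'a::real_normed_vector) \<Rightarrow> bool" where
  "piecewise_smooth_path \<gamma> \<longleftrightarrow>
     path \<gamma> \<and>
     (\<exists>S. finite S \<and>
       (\<forall>a b. 0 \<le> a \<and> a < b \<and> b \<le> 1 \<and> {a<..<b} \<inter> S = {} \<longrightarrow> smooth_on_interval a b \<gamma>))"

text \<open>The tangency condition is imposed wherever \<open>\<gamma>\<close> is differentiable, hence at all but finitely
  many points. If the subspaces \<open>\<xi> p\<close> form a closed set, as for a vector subbundle, then the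
  one-sided derivatives at the break points are tangent to \<open>\<xi>\<close> as well.\<close>

definition horizontal_path ::
    "(complex ^ 'm) set \<Rightarrow> (complex ^ 'm \<Rightarrow> (complex ^ 'm) set) \<Rightarrow> (real \<Rightarrow> complex ^ 'm) \<Rightarrow> bool" where
  "horizontal_path M \<xi> \<gamma> \<longleftrightarrow>
     piecewise_smooth_path \<gamma> \<and> path_image \<gamma> \<subseteq> M \<and>
     (\<forall>t\<in>{0..1}. \<forall>v. (\<gamma> has_vector_derivative v) (at t within {0..1}) \<longrightarrow> v \<in> \<xi> (\<gamma> t))"

text \<open>The value of \<open>vector_derivative\<close> at the finitely many break points does not affect the
  integral. Infima over the empty set are \<open>\<infinity>\<close>.\<close>

definition kobayashi_dist ::
    "(complex ^ 'm) set \<Rightarrow> (complex ^ 'm \<Rightarrow> (complex ^ 'm) set) \<Rightarrow> complex ^ 'm \<Rightarrow> complex ^ 'm \<Rightarrow> ennreal" where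
  "kobayashi_dist M \<xi> p q =
     Inf {(\<integral>\<^sup>+ t\<in>{0..1}. kobayashi_norm M \<xi> (\<gamma> t) (vector_derivative \<gamma> (at t within {0..1})) \<partial>lborel) | \<gamma>.
          horizontal_path M \<xi> \<gamma> \<and> pathstart \<gamma> = p \<and> pathfinish \<gamma> = q}"

definition directed_hyperbolic ::
    "(complex ^ 'm) set \<Rightarrow> (complex ^ 'm \<Rightarrow> (complex ^ 'm) set) \<Rightarrow> bool" where
  "directed_hyperbolic M \<xi> \<longleftrightarrow> (\<forall>p\<in>M. \<forall>q\<in>M. p \<noteq> q \<longrightarrow> kobayashi_dist M \<xi> p q > 0)"


section \<open>The standard contact form\<close>

text \<open>With \<open>n = CARD('n)\<close>, the left summand \<open>'n + 'n\<close> of the index type carries the coordinates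
  \<open>(x,y)\<close> and the right summand carries \<open>z\<close>.\<close>

type_synonym 'n contact_space = "complex ^ (('n + 'n) + unit)"

definition xy_part :: "'n::finite contact_space \<Rightarrow> complex ^ ('n + 'n)" where
  "xy_part p = (\<chi> i. p $ Inl i)"

definition x_coord :: "'n::finite contact_space \<Rightarrow> 'n \<Rightarrow> complex" where
  "x_coord p j = p $ Inl (Inl j)"

definition y_coord :: "'n::finite contact_space \<Rightarrow> 'n \<Rightarrow> complex" where
  "y_coord p j = p $ Inl (Inr j)"

definition z_coord :: "'n::finite contact_space \<Rightarrow> complex" where
  "z_coord p = p $ Inr ()"

definition alpha0 :: "'n::finite contact_space \<Rightarrow> 'n contact_space \<Rightarrow> complex" where
  "alpha0 p v = z_coord v + (\<Sum>j\<in>UNIV. x_coord p j * y_coord v j)"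

definition alpha0_hyperbolic :: "'n::finite contact_space set \<Rightarrow> bool" where
  "alpha0_hyperbolic \<Omega> \<longleftrightarrow> directed_hyperbolic \<Omega> (\<lambda>p. {v. alpha0 p v = 0})"


section \<open>The removed set\<close>

definition unit_polydisk :: "(complex ^ 'm) set" where
  "unit_polydisk = {w. \<forall>i. norm (w $ i) < 1}"

definition K_set :: "(nat \<Rightarrow> real) \<Rightarrow> 'n::finite contact_space set" where
  "K_set C = (\<Union>N\<in>{1..}.
     {p. xy_part p \<in> (\<lambda>w. (2 ^ (N - 1) :: real) *\<^sub>R w) ` frontier unit_polydisk \<and>
         z_coord p \<in> (\<lambda>w. C N *\<^sub>R w) ` cball 0 1})"

definition Omega0 :: "(nat \<Rightarrow> real) \<Rightarrow> 'n::finite contact_space set" where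
  "Omega0 C = UNIV - K_set C"

end

theory Submission
  imports Defs "HOL-Complex_Analysis.Cauchy_Integral_Formula"
begin

text \<open>
  The removed set is a sequence of walls: in the maximum norm of \<open>(x,y)\<close>, the \<open>N\<close>-th wall
  occupies the sphere of radius \<open>2 ^ (N - 1)\<close>, but only over the disk of radius \<open>C N\<close> in the
  \<open>z\<close>-axis. A disk can pass a wall only by moving its \<open>z\<close>-coordinate far out, and for a
  horizontal disk this is expensive, since \<open>z' = - (\<Sum>j. x\<^sub>j y\<^sub>j')\<close>.

  Quantitatively, suppose that a horizontal disk satisfies \<open>\<bar>(x,y)\<bar> \<le> 2 ^ N\<close> on a disk of radius
  \<open>\<rho>\<close> and starts at a height \<open>\<bar>z\<bar> \<le> n 2 ^ (3 N)\<close>. On the disk of radius \<open>\<rho> (1 - 2 ^ (-N))\<close>, Cauchy's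
  estimate costs a factor \<open>2 ^ N / \<rho>\<close>, so \<open>\<bar>z'\<bar> \<le> n 2 ^ (3 N) / \<rho>\<close> there and \<open>z\<close> moves by at most
  \<open>n 2 ^ (3 N)\<close>. By the lower bound on \<open>C N\<close> this does not suffice to climb over
  the \<open>N\<close>-th wall. If the centre lies inside that wall, then so does, by connectedness, the whole
  smaller disk, that is, \<open>\<bar>(x,y)\<bar> < 2 ^ (N - 1)\<close> on it (\<open>descend_one_level\<close>).

  Every horizontal disk is bounded on the disk of radius \<open>1/2\<close>, hence lies below some level
  \<open>2 ^ M\<close> there, and the descent can begin at this \<open>M\<close>. The radii shrink by the factors
  \<open>1 - 2 ^ (-N)\<close>, whose infinite product is positive. Therefore the descent ends, on a disk of
  radius \<open>1/4\<close> that is independent of \<open>M\<close>, at a level that depends only on the size of the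
  centre (\<open>confinement\<close>). Cauchy's estimate at the centre then bounds the derivative of the disk,
  so the Kobayashi norm is bounded below by a multiple of the Euclidean norm on every ball
  (\<open>kobayashi_norm_lower_bound\<close>). A path between distinct points \<open>p\<close> and \<open>q\<close> must leave every
  ball about \<open>p\<close> of radius smaller than the distance of \<open>p\<close> and \<open>q\<close>, which costs a positive
  length (\<open>hyperbolic_of_local_bound\<close>).

  The domain is open because only finitely many walls meet a bounded set, and connected because
  each point can rise radially in \<open>z\<close> above all walls relevant to it and then contract to
  \<open>(x,y) = 0\<close>.
\<close>

section \<open>The maximum norm and the removed set\<close>

text \<open>The norm whose unit ball is the polydisk. It differs from \<open>infnorm\<close>, which takes the maximum
  over real and imaginary parts.\<close>

definition polynorm :: "complex ^ 'm::finite \<Rightarrow> real" where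
  "polynorm w = Max (range (\<lambda>i. norm (w $ i)))"

lemma polynorm_le_iff: "polynorm w \<le> r \<longleftrightarrow> (\<forall>i. norm (w $ i) \<le> r)"
  unfolding polynorm_def by (subst Max_le_iff) auto

lemma polynorm_less_iff: "polynorm w < r \<longleftrightarrow> (\<forall>i. norm (w $ i) < r)"
  unfolding polynorm_def by (subst Max_less_iff) auto

lemma norm_nth_le_polynorm: "norm (w $ i) \<le> polynorm w"
  using polynorm_le_iff[of w "polynorm w"] by blast

lemma polynorm_nonneg: "0 \<le> polynorm w"
  using norm_nth_le_polynorm[of w] norm_ge_zero order_trans by blast

lemma polynorm_scaleR: "polynorm (t *\<^sub>R w) = \<bar>t\<bar> * polynorm w"
proof (rule antisym)
  show "polynorm (t *\<^sub>R w) \<le> \<bar>t\<bar> * polynorm w"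
    by (simp add: polynorm_le_iff mult_left_mono norm_nth_le_polynorm)
  show "\<bar>t\<bar> * polynorm w \<le> polynorm (t *\<^sub>R w)"
  proof (cases "t = 0")
    case False
    have "norm (w $ i) \<le> polynorm (t *\<^sub>R w) / \<bar>t\<bar>" for i
      using norm_nth_le_polynorm[of "t *\<^sub>R w" i] False by (simp add: field_simps)
    then have "polynorm w \<le> polynorm (t *\<^sub>R w) / \<bar>t\<bar>"
      by (simp add: polynorm_le_iff)
    then show ?thesis using False by (simp add: field_simps)
  qed (simp add: polynorm_nonneg)
qed

lemma polynorm_diff_le: "polynorm v - polynorm w \<le> norm (v - w)"
proof -
  have "norm (v $ i) \<le> polynorm w + norm (v - w)" for i
    using norm_nth_le_polynorm[of w i] Finite_Cartesian_Product.norm_nth_le[of "v - w" i] norm_triangle_sub[of "v $ i" "w $ i"]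
    by simp
  then show ?thesis
    using polynorm_le_iff[of v "polynorm w + norm (v - w)"] by simp
qed

lemma continuous_on_polynorm [continuous_intros]:
  fixes f :: "'a::topological_space \<Rightarrow> complex ^ 'b::finite"
  assumes "continuous_on S f"
  shows "continuous_on S (\<lambda>x. polynorm (f x))"
proof -
  have "\<bar>polynorm v - polynorm w\<bar> \<le> norm (v - w)" for v w :: "complex ^ 'b"
    using polynorm_diff_le[of v w] polynorm_diff_le[of w v] by (simp add: norm_minus_commute)
  then have "1-lipschitz_on UNIV (polynorm :: complex ^ 'b \<Rightarrow> real)"
    by (intro lipschitz_onI) (auto simp: dist_norm)
  then have "continuous_on UNIV (polynorm :: complex ^ 'b \<Rightarrow> real)"
    by (rule lipschitz_on_continuous_on)
  from continuous_on_compose2[OF this assms] show ?thesis by simp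
qed

lemma unit_polydisk_eq: "unit_polydisk = {w. polynorm w < 1}"
  by (simp add: unit_polydisk_def polynorm_less_iff)

text \<open>A point of norm at most \<open>1\<close> is the limit of its multiples by factors \<open>t < 1\<close>, which lie in the
  polydisk. So the closure is the closed polydisk.\<close>

lemma frontier_unit_polydisk:
  "frontier unit_polydisk = {w :: complex ^ 'm::finite. polynorm w = 1}"
proof -
  have op: "open (unit_polydisk :: (complex ^ 'm) set)"
    unfolding unit_polydisk_eq by (intro open_Collect_less continuous_intros)
  have "closure unit_polydisk \<subseteq> {w :: complex ^ 'm. polynorm w \<le> 1}"
    by (rule closure_minimal) (auto simp: unit_polydisk_eq intro!: closed_Collect_le continuous_intros)
  moreover have "w \<in> closure unit_polydisk" if "polynorm w \<le> 1" for w :: "complex ^ 'm"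
  proof -
    have "t *\<^sub>R w \<in> unit_polydisk" if "t \<in> {0..<1}" for t
    proof -
      have "t * polynorm w \<le> t * 1"
        using that \<open>polynorm w \<le> 1\<close> by (intro mult_left_mono) auto
      then show ?thesis
        using that by (simp add: unit_polydisk_eq polynorm_scaleR)
    qed
    then have "(\<lambda>t. t *\<^sub>R w) ` {0..<1::real} \<subseteq> closure unit_polydisk"
      using closure_subset by blast
    then have "(\<lambda>t. t *\<^sub>R w) ` closure {0..<1::real} \<subseteq> closure unit_polydisk"
      by (rule image_closure_subset[rotated 2]) (auto intro!: continuous_intros)
    moreover have "1 *\<^sub>R w \<in> (\<lambda>t. t *\<^sub>R w) ` closure {0..<1::real}"
      by (rule imageI) simp
    ultimately have "1 *\<^sub>R w \<in> closure unit_polydisk" by (rule subsetD)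
    then show ?thesis by simp
  qed
  ultimately show ?thesis
    using op by (auto simp: frontier_def interior_open unit_polydisk_eq)
qed

lemma polynorm_sphere_image:
  assumes "r > 0"
  shows "(\<lambda>w. r *\<^sub>R w) ` frontier unit_polydisk = {w. polynorm w = r}"
proof -
  have "w \<in> (\<lambda>w. r *\<^sub>R w) ` {w. polynorm w = 1}" if "polynorm w = r" for w :: "complex ^ 'a"
  proof (rule image_eqI)
    show "w = r *\<^sub>R ((1 / r) *\<^sub>R w)" using assms by simp
    show "(1 / r) *\<^sub>R w \<in> {w. polynorm w = 1}" using assms that by (simp add: polynorm_scaleR)
  qed
  moreover have "polynorm (r *\<^sub>R w) = r" if "polynorm w = 1" for w :: "complex ^ 'a"
    using assms that by (simp add: polynorm_scaleR)
  ultimately show ?thesis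
    unfolding frontier_unit_polydisk by blast
qed

text \<open>The form in which the domain enters all later arguments.\<close>

lemma Omega0_iff:
  fixes p :: "'n::finite contact_space"
  assumes "\<And>N. N \<ge> 1 \<Longrightarrow> C N > 0"
  shows "p \<in> Omega0 C \<longleftrightarrow>
    (\<forall>N\<ge>1. polynorm (xy_part p) = 2 ^ (N - 1) \<longrightarrow> C N < norm (z_coord p))"
proof -
  have "z_coord p \<in> (\<lambda>w. C N *\<^sub>R w) ` cball 0 1 \<longleftrightarrow> norm (z_coord p) \<le> C N" if "N \<ge> 1" for N
    using cball_scale[of "C N" "0::complex" 1] assms[OF that] by simp
  then show ?thesis
    unfolding Omega0_def K_set_def polynorm_sphere_image[OF zero_less_power[OF zero_less_numeral]]
    by (auto simp: not_le)
qed

lemma continuous_on_xy_part [continuous_intros]: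
  assumes "continuous_on S f" shows "continuous_on S (\<lambda>x. xy_part (f x))"
  unfolding xy_part_def by (intro continuous_intros assms)

lemma continuous_on_z_coord [continuous_intros]:
  assumes "continuous_on S f" shows "continuous_on S (\<lambda>x. z_coord (f x))"
  unfolding z_coord_def by (intro continuous_intros assms)

text \<open>Each component of the removed set is closed, and the family is locally finite: near \<open>p\<close> the norm
  of \<open>(x,y)\<close> stays below some \<open>2 ^ M\<close>, so only the components with index at most \<open>M\<close> come close.\<close>

lemma open_Omega0:
  assumes pos: "\<And>N. N \<ge> 1 \<Longrightarrow> C N > 0"
  shows "open (Omega0 C :: 'n::finite contact_space set)"
proof (rule Topological_Spaces.openI)
  fix p :: "'n contact_space"
  assume p: "p \<in> Omega0 C"
  obtain M where M: "polynorm (xy_part p) < 2 ^ M"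
    using real_arch_pow[of 2] by auto
  define B where "B N = {q :: 'n contact_space. polynorm (xy_part q) = 2 ^ (N - 1) \<and> norm (z_coord q) \<le> C N}" for N
  define T where "T = {q. polynorm (xy_part q) < 2 ^ M} - (\<Union>N\<in>{1..M}. B N)"
  have "closed (B N)" for N
    unfolding B_def by (intro closed_Collect_conj closed_Collect_eq closed_Collect_le continuous_intros)
  then have "open T"
    unfolding T_def by (intro open_Diff closed_UN open_Collect_less continuous_intros) auto
  moreover have "p \<in> T"
    using p M by (auto simp: T_def B_def Omega0_iff[OF pos])
  moreover have "T \<subseteq> Omega0 C"
  proof
    fix q assume q: "q \<in> T"
    have "C N < norm (z_coord q)" if "N \<ge> 1" "polynorm (xy_part q) = 2 ^ (N - 1)" for N
    proof -
      have "(2::real) ^ (N - 1) < 2 ^ M" using q that by (simp add: T_def)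
      then have "N \<in> {1..M}" using that by (simp add: power_strict_increasing_iff)
      then show ?thesis using q that by (auto simp: T_def B_def)
    qed
    then show "q \<in> Omega0 C" by (simp add: Omega0_iff[OF pos])
  qed
  ultimately show "\<exists>T. open T \<and> p \<in> T \<and> T \<subseteq> Omega0 C" by blast
qed

definition join_xyz :: "complex ^ ('n + 'n) \<Rightarrow> complex \<Rightarrow> 'n::finite contact_space" where
  "join_xyz w z = (\<chi> i. case i of Inl k \<Rightarrow> w $ k | Inr _ \<Rightarrow> z)"

lemma join_xyz_simps [simp]:
  "xy_part (join_xyz w z) = w" "z_coord (join_xyz w z) = z"
  "join_xyz (xy_part p) (z_coord p) = p"
  by (auto simp: join_xyz_def xy_part_def z_coord_def vec_eq_iff split: sum.split)

lemma continuous_on_join_xyz [continuous_intros]: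
  fixes f :: "'a::topological_space \<Rightarrow> complex ^ ('n::finite + 'n)"
  assumes "continuous_on S f" "continuous_on S g"
  shows "continuous_on S (\<lambda>x. join_xyz (f x) (g x))"
  unfolding join_xyz_def
proof (intro continuous_on_vec_lambda)
  show "continuous_on S (\<lambda>x. case i of Inl k \<Rightarrow> f x $ k | Inr _ \<Rightarrow> g x)" for i :: "('n + 'n) + unit"
    by (cases i) (auto intro!: continuous_intros assms)
qed

lemma connected_component_image_interval:
  fixes h :: "real \<Rightarrow> 'a::topological_space"
  assumes "a \<le> b" "continuous_on {a..b} h" "h ` {a..b} \<subseteq> S"
  shows "connected_component S (h a) (h b)"
  using assms connected_continuous_image[OF assms(2)]
  by (intro connected_component_of_subset[OF _ assms(3)]) (auto simp: connected_component_def intro!: exI[of _ "h ` {a..b}"])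

text \<open>Every point can be joined to the origin by three segments. Along the first, \<open>z\<close> moves radially
  outwards, which never leaves the domain, until it is higher than all components whose sphere is
  at most as large as that of the given point. At this height \<open>(x,y)\<close> can be contracted to \<open>0\<close>.
  Over \<open>(x,y) = 0\<close> nothing is removed, and \<open>z\<close> can return to \<open>0\<close>.\<close>

lemma connected_Omega0:
  assumes pos: "\<And>N. N \<ge> 1 \<Longrightarrow> C N > 0"
  shows "connected (Omega0 C :: 'n::finite contact_space set)"
proof -
  have "connected_component (Omega0 C) p (join_xyz 0 0)" if p: "p \<in> Omega0 C" for p :: "'n contact_space"
  proof -
    define w z where "w = xy_part p" and "z = z_coord p"
    obtain M where M: "polynorm w < 2 ^ M"
      using real_arch_pow[of 2] by auto
    \<comment> \<open>A height above the point itself and above every component that the contraction can meet.\<close>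
    define R where "R = norm z + (\<Sum>N\<in>{1..M}. C N) + 1"
    have C_nonneg: "0 \<le> C N" if "N \<in> {1..M}" for N
      using pos[of N] that by simp
    have "0 \<le> (\<Sum>N\<in>{1..M}. C N)"
      using C_nonneg by (rule sum_nonneg)
    then have R: "norm z \<le> R" "0 \<le> R" by (auto simp: R_def)
    have C_R: "C N < R" if "N \<in> {1..M}" for N
    proof -
      have "C N \<le> (\<Sum>N\<in>{1..M}. C N)"
        using that C_nonneg by (intro member_le_sum) auto
      then show ?thesis
        using norm_ge_zero[of z] unfolding R_def by linarith
    qed
    \<comment> \<open>The direction of \<open>z\<close>; it is a unit vector also for \<open>z = 0\<close>.\<close>
    define u where "u = cis (Arg z)"
    have u: "norm u = 1" "of_real (norm z) * u = z"
      using rcis_cmod_Arg[of z] by (auto simp: u_def rcis_def)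
    have norm_zero: "polynorm (0 :: complex ^ ('n + 'n)) = 0"
      using polynorm_scaleR[of 0 0] by simp
    have rise: "connected_component (Omega0 C) (join_xyz w (of_real (norm z) * u)) (join_xyz w (of_real R * u))"
    proof (rule connected_component_image_interval[where h = "\<lambda>s. join_xyz w (of_real s * u)"])
      show "(\<lambda>s. join_xyz w (of_real s * u)) ` {norm z..R} \<subseteq> Omega0 C"
        using p u by (fastforce simp: Omega0_iff[OF pos] norm_mult w_def z_def)
    qed (use R in \<open>auto intro!: continuous_intros\<close>)
    have contract: "connected_component (Omega0 C) (join_xyz (0 *\<^sub>R w) (of_real R * u)) (join_xyz (1 *\<^sub>R w) (of_real R * u))"
    proof (rule connected_component_image_interval[where h = "\<lambda>t. join_xyz (t *\<^sub>R w) (of_real R * u)"])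
      show "(\<lambda>t. join_xyz (t *\<^sub>R w) (of_real R * u)) ` {0..1} \<subseteq> Omega0 C"
      proof clarify
        fix t :: real assume t: "t \<in> {0..1}"
        have "C N < R" if "N \<ge> 1" "polynorm (t *\<^sub>R w) = 2 ^ (N - 1)" for N
        proof -
          have "t * polynorm w \<le> 1 * polynorm w"
            using t by (intro mult_right_mono polynorm_nonneg) auto
          moreover have "t * polynorm w = 2 ^ (N - 1)"
            using that t by (simp add: polynorm_scaleR)
          ultimately have "(2::real) ^ (N - 1) < 2 ^ M"
            using M by linarith
          then show ?thesis
            using that by (intro C_R) (simp add: power_strict_increasing_iff)
        qed
        then show "join_xyz (t *\<^sub>R w) (of_real R * u) \<in> Omega0 C"
          using R u by (simp add: Omega0_iff[OF pos] norm_mult)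
      qed
    qed (auto intro!: continuous_intros)
    have return: "connected_component (Omega0 C) (join_xyz (0 :: complex ^ ('n + 'n)) (of_real 0 * u)) (join_xyz 0 (of_real R * u))"
    proof (rule connected_component_image_interval[where h = "\<lambda>s. join_xyz 0 (of_real s * u)"])
      show "(\<lambda>s. join_xyz (0 :: complex ^ ('n + 'n)) (of_real s * u)) ` {0..R} \<subseteq> Omega0 C"
        by (auto simp: Omega0_iff[OF pos] norm_zero)
    qed (use R in \<open>auto intro!: continuous_intros\<close>)
    have "connected_component (Omega0 C) (join_xyz w z) (join_xyz w (of_real R * u))"
      using rise by (simp only: u(2))
    moreover have "connected_component (Omega0 C) (join_xyz w (of_real R * u)) (join_xyz 0 (of_real R * u))"
      using connected_component_sym[OF contract] by simp
    moreover have "connected_component (Omega0 C) (join_xyz 0 (of_real R * u)) (join_xyz 0 0 :: 'n contact_space)"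
      using connected_component_sym[OF return] by simp
    ultimately have "connected_component (Omega0 C) (join_xyz w z) (join_xyz 0 0)"
      using connected_component_trans by blast
    then show ?thesis
      by (simp add: w_def z_def)
  qed
  then show ?thesis
    unfolding connected_iff_connected_component
    by (meson connected_component_sym connected_component_trans)
qed

section \<open>Horizontal disks\<close>

lemma horizontal_disk_z_deriv:
  assumes "horizontal_disk M (\<lambda>p. {v. alpha0 p v = 0}) f" "\<zeta> \<in> ball 0 1"
  shows "deriv (\<lambda>w. z_coord (f w)) \<zeta> =
    - (\<Sum>j\<in>UNIV. x_coord (f \<zeta>) j * deriv (\<lambda>w. y_coord (f w) j) \<zeta>)"
  using assms
  by (auto simp: horizontal_disk_def alpha0_def disk_deriv_def z_coord_def y_coord_def
        add_eq_0_iff2)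

lemma horizontal_disk_continuous_on:
  assumes "horizontal_disk M \<xi> f"
  shows "continuous_on (ball 0 1) f"
proof -
  have "continuous_on (ball 0 1) (\<lambda>\<zeta>. \<chi> i. f \<zeta> $ i)"
    using assms by (intro continuous_on_vec_lambda) (auto simp: horizontal_disk_def intro: holomorphic_on_imp_continuous_on)
  then show ?thesis by simp
qed

lemma deriv_bound_cball:
  assumes "g holomorphic_on ball 0 1" "\<And>\<zeta>. \<zeta> \<in> cball 0 \<rho> \<Longrightarrow> norm (g \<zeta>) \<le> B"
    and "\<rho> < 1" "r > 0" "norm \<zeta> + r \<le> \<rho>"
  shows "norm (deriv g \<zeta>) \<le> B / r"
proof -
  have sub: "cball \<zeta> r \<subseteq> cball 0 \<rho>"
  proof
    fix w assume "w \<in> cball \<zeta> r"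
    then show "w \<in> cball 0 \<rho>"
      using norm_triangle_sub[of w \<zeta>] assms(5) by (simp add: dist_norm norm_minus_commute)
  qed
  then have sub': "cball \<zeta> r \<subseteq> ball 0 1" using assms(3) by auto
  have "norm ((deriv ^^ 1) g \<zeta>) \<le> fact 1 * B / r ^ 1"
  proof (rule Cauchy_inequality)
    show "g holomorphic_on ball \<zeta> r"
      using assms(1) sub' by (meson ball_subset_cball holomorphic_on_subset order_trans)
    show "continuous_on (cball \<zeta> r) g"
      using assms(1) sub' holomorphic_on_imp_continuous_on holomorphic_on_subset by blast
    show "norm (g x) \<le> B" if "norm (\<zeta> - x) = r" for x
      using that sub by (intro assms(2)) (auto simp: dist_norm)
  qed fact
  then show ?thesis by simp
qed

text \<open>The contact equation turns a bound \<open>B\<close> for \<open>(x,y)\<close> into a bound for \<open>z'\<close>: in each product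
  \<open>x\<^sub>j y\<^sub>j'\<close> the first factor is at most \<open>B\<close>, and the second at most \<open>B / r\<close> by Cauchy's estimate.\<close>

lemma horizontal_disk_z_deriv_bound:
  fixes f :: "complex \<Rightarrow> 'n::finite contact_space"
  assumes f: "horizontal_disk M (\<lambda>p. {v. alpha0 p v = 0}) f"
    and B: "\<And>\<zeta>. \<zeta> \<in> cball 0 \<rho> \<Longrightarrow> polynorm (xy_part (f \<zeta>)) \<le> B"
    and "\<rho> < 1" "r > 0" "norm \<zeta> + r \<le> \<rho>"
  shows "norm (deriv (\<lambda>w. z_coord (f w)) \<zeta>) \<le> real CARD('n) * B\<^sup>2 / r"
proof -
  have comp: "norm (f \<eta> $ Inl k) \<le> B" if "\<eta> \<in> cball 0 \<rho>" for \<eta> k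
    using B[OF that] norm_nth_le_polynorm[of "xy_part (f \<eta>)" k] by (simp add: xy_part_def)
  have \<zeta>: "\<zeta> \<in> cball 0 \<rho>" "\<zeta> \<in> ball 0 1" using assms by auto
  then have "B \<ge> 0" using comp norm_ge_zero order_trans by blast
  have "norm (x_coord (f \<zeta>) j * deriv (\<lambda>w. y_coord (f w) j) \<zeta>) \<le> B * (B / r)" for j
    unfolding norm_mult
  proof (intro mult_mono)
    show "norm (deriv (\<lambda>w. y_coord (f w) j) \<zeta>) \<le> B / r"
      using f comp assms(3-5) unfolding y_coord_def horizontal_disk_def
      by (intro deriv_bound_cball[where \<rho> = \<rho>]) auto
  qed (use comp \<zeta> \<open>B \<ge> 0\<close> in \<open>auto simp: x_coord_def\<close>)
  then have "norm (\<Sum>j\<in>UNIV. x_coord (f \<zeta>) j * deriv (\<lambda>w. y_coord (f w) j) \<zeta>) \<le> (\<Sum>j\<in>(UNIV::'n set). B * (B / r))"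
    by (intro sum_norm_le)
  then show ?thesis
    by (simp add: horizontal_disk_z_deriv[OF f \<zeta>(2)] power2_eq_square)
qed

text \<open>At a point of norm at most \<open>\<rho> (1 - s)\<close> Cauchy's estimate is available with radius \<open>\<rho> s\<close>. The
  factor \<open>\<rho>\<close> cancels when \<open>z'\<close> is integrated from the centre, so the bound is invariant under
  rescaling of the disk.\<close>

lemma horizontal_disk_z_growth:
  fixes f :: "complex \<Rightarrow> 'n::finite contact_space"
  assumes f: "horizontal_disk M (\<lambda>p. {v. alpha0 p v = 0}) f"
    and B: "\<And>\<zeta>. \<zeta> \<in> cball 0 \<rho> \<Longrightarrow> polynorm (xy_part (f \<zeta>)) \<le> B"
    and "0 < \<rho>" "\<rho> < 1" "0 < s" "s < 1" and \<zeta>: "\<zeta> \<in> cball 0 (\<rho> * (1 - s))"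
  shows "norm (z_coord (f \<zeta>) - z_coord (f 0)) \<le> real CARD('n) * B\<^sup>2 / s"
proof -
  let ?S = "cball (0::complex) (\<rho> * (1 - s))" and ?z = "\<lambda>w. z_coord (f w)"
  have le: "\<rho> * (1 - s) \<le> \<rho>" using \<open>0 < \<rho>\<close> \<open>0 < s\<close> by (simp add: algebra_simps)
  have "0 \<le> \<rho> * (1 - s)" using \<open>0 < \<rho>\<close> \<open>s < 1\<close> by simp
  have "norm (?z \<zeta> - ?z 0) \<le> (real CARD('n) * B\<^sup>2 / (\<rho> * s)) * norm (\<zeta> - 0)"
  proof (rule field_differentiable_bound[where S = ?S and f' = "deriv ?z"])
    fix w assume w: "w \<in> ?S"
    then have "norm w \<le> \<rho> * (1 - s)" by simp
    then have "w \<in> ball 0 1" using le \<open>\<rho> < 1\<close> by (simp del: mult_le_cancel_left1)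
    moreover have "?z holomorphic_on ball 0 1"
      using f by (simp add: horizontal_disk_def z_coord_def)
    ultimately show "(?z has_field_derivative deriv ?z w) (at w within ?S)"
      using holomorphic_derivI[OF _ open_ball] by blast
    show "norm (deriv ?z w) \<le> real CARD('n) * B\<^sup>2 / (\<rho> * s)"
      using w \<open>0 < \<rho>\<close> \<open>\<rho> < 1\<close> \<open>0 < s\<close>
      by (intro horizontal_disk_z_deriv_bound[OF f B]) (simp_all add: algebra_simps)
  qed (use \<zeta> \<open>0 \<le> \<rho> * (1 - s)\<close> in simp_all)
  also have "\<dots> \<le> (real CARD('n) * B\<^sup>2 / (\<rho> * s)) * \<rho>"
  proof (rule mult_left_mono)
    have "norm \<zeta> \<le> \<rho> * (1 - s)" using \<zeta> by simp
    then have "norm \<zeta> \<le> \<rho>" using le by linarith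
    then show "norm (\<zeta> - 0) \<le> \<rho>" by simp
  qed (use \<open>0 < \<rho>\<close> \<open>0 < s\<close> in simp)
  also have "\<dots> = real CARD('n) * B\<^sup>2 / s" using \<open>0 < \<rho>\<close> by simp
  finally show ?thesis .
qed

text \<open>By the growth estimate with \<open>s = 2 ^ (-N)\<close>, the height changes by at most \<open>n 2 ^ (3 N)\<close> and stays
  at most \<open>n 2 ^ (3 N + 1) \<le> C N\<close> on the smaller disk. There \<open>(x,y)\<close> cannot meet the sphere of
  radius \<open>2 ^ (N - 1)\<close>, and by connectedness it remains on the side of this sphere on which it
  starts.\<close>

lemma descend_one_level:
  fixes C :: "nat \<Rightarrow> real" and f :: "complex \<Rightarrow> 'n::finite contact_space"
  assumes pos: "\<And>N. N \<ge> 1 \<Longrightarrow> C N > 0"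
    and C: "C N \<ge> real CARD('n) * 2 ^ (3 * N + 1)"
    and f: "horizontal_disk (Omega0 C) (\<lambda>p. {v. alpha0 p v = 0}) f"
    and N: "N \<ge> 1"
    and xy0: "polynorm (xy_part (f 0)) < 2 ^ (N - 1)"
    and z0: "norm (z_coord (f 0)) \<le> real CARD('n) * 2 ^ (3 * N)"
    and \<rho>: "0 < \<rho>" "\<rho> < 1"
    and B: "\<And>\<zeta>. \<zeta> \<in> cball 0 \<rho> \<Longrightarrow> polynorm (xy_part (f \<zeta>)) \<le> 2 ^ N"
    and \<zeta>: "\<zeta> \<in> cball 0 (\<rho> * (1 - 1 / 2 ^ N))"
  shows "polynorm (xy_part (f \<zeta>)) < 2 ^ (N - 1)"
proof -
  let ?S = "cball (0::complex) (\<rho> * (1 - 1 / 2 ^ N))" and ?h = "\<lambda>\<zeta>. polynorm (xy_part (f \<zeta>))"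
  have s: "0 < 1 / (2::real) ^ N" "1 / (2::real) ^ N < 1"
    using N by (auto simp: one_less_power)
  have "\<rho> * (1 - 1 / 2 ^ N) \<le> \<rho>" using \<rho> by (simp add: algebra_simps)
  then have "\<rho> * (1 - 1 / 2 ^ N) < 1" using \<rho> by linarith
  then have sub: "?S \<subseteq> ball 0 1" by (intro cball_subset_ball_iff[THEN iffD2]) simp
  have avoid: "?h \<eta> \<noteq> 2 ^ (N - 1)" if "\<eta> \<in> ?S" for \<eta>
  proof
    assume eq: "?h \<eta> = 2 ^ (N - 1)"
    have "f \<eta> \<in> Omega0 C" using f that sub by (auto simp: horizontal_disk_def)
    then have "C N < norm (z_coord (f \<eta>))"
      using eq N by (simp add: Omega0_iff[OF pos])
    also have "\<dots> \<le> norm (z_coord (f 0)) + norm (z_coord (f \<eta>) - z_coord (f 0))"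
      by (rule norm_triangle_sub)
    also have "norm (z_coord (f \<eta>) - z_coord (f 0)) \<le> real CARD('n) * (2 ^ N)\<^sup>2 / (1 / 2 ^ N)"
      by (rule horizontal_disk_z_growth[OF f B \<rho> s that])
    also have "real CARD('n) * (2 ^ N)\<^sup>2 / (1 / 2 ^ N) = real CARD('n) * 2 ^ (3 * N)"
      by (simp add: power_mult power2_eq_square power3_eq_cube flip: power_mult_distrib)
    finally show False using z0 C by simp
  qed
  have "continuous_on ?S ?h"
    using horizontal_disk_continuous_on[OF f] sub by (intro continuous_intros) (rule continuous_on_subset)
  then have conn: "connected (?h ` ?S)"
    by (rule connected_continuous_image) (rule connected_cball)
  have "0 \<in> ?S" using \<rho> s by simp
  show ?thesis
  proof (rule ccontr)
    assume "\<not> ?h \<zeta> < 2 ^ (N - 1)"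
    then have "2 ^ (N - 1) \<le> ?h \<zeta>" by (simp only: not_less)
    then have "2 ^ (N - 1) \<in> ?h ` ?S"
      by (rule connectedD_interval[OF conn imageI[OF \<open>0 \<in> ?S\<close>] imageI[OF \<zeta>] less_imp_le[OF xy0]])
    then obtain \<eta> where "\<eta> \<in> ?S" "?h \<eta> = 2 ^ (N - 1)" by (rule imageE) simp
    then show False using avoid by blast
  qed
qed

text \<open>Descending induction on the level, from a level at which the bound is trivial by compactness down
  to \<open>L\<close>. The point is that the radius \<open>1/4\<close> is the same for all disks, although the initial
  level is not.\<close>

lemma confinement:
  fixes C :: "nat \<Rightarrow> real" and f :: "complex \<Rightarrow> 'n::finite contact_space"
  assumes pos: "\<And>N. N \<ge> 1 \<Longrightarrow> C N > 0"
    and C: "\<And>N. N \<ge> 1 \<Longrightarrow> C N \<ge> real CARD('n) * 2 ^ (3 * N + 1)"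
    and f: "horizontal_disk (Omega0 C) (\<lambda>p. {v. alpha0 p v = 0}) f"
    and L: "L \<ge> 1"
    and f0: "norm (f 0) < 2 ^ L"
    and \<zeta>: "\<zeta> \<in> cball 0 (1 / 4)"
  shows "polynorm (xy_part (f \<zeta>)) \<le> 2 ^ L"
proof -
  \<comment> \<open>Explicit radii with \<open>\<rho> N \<le> \<rho> (Suc N) (1 - 2 ^ (-Suc N))\<close>, since
    \<open>(1 - 2 ^ (-Suc N))\<^sup>2 \<ge> 1 - 2 ^ (-N)\<close>. They lie between \<open>1/4\<close> (for \<open>N \<ge> 1\<close>) and \<open>1/2\<close>.\<close>
  define \<rho> where "\<rho> N = (1 - 1 / 2 ^ N) / (2::real)" for N :: nat
  have "compact (cball (0::complex) (1/2))" by simp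
  moreover have "continuous_on (cball (0::complex) (1/2)) (\<lambda>\<zeta>. polynorm (xy_part (f \<zeta>)))"
    using horizontal_disk_continuous_on[OF f] by (intro continuous_intros) (rule continuous_on_subset, auto)
  ultimately have "bounded ((\<lambda>\<zeta>. polynorm (xy_part (f \<zeta>))) ` cball 0 (1/2))"
    by (intro compact_imp_bounded compact_continuous_image)
  then obtain R where R: "\<And>\<zeta>. \<zeta> \<in> cball 0 (1/2) \<Longrightarrow> polynorm (xy_part (f \<zeta>)) \<le> R"
    unfolding bounded_iff by (metis abs_le_D1 image_eqI real_norm_def)
  obtain M0 where M0: "R < 2 ^ M0" using real_arch_pow[of 2 R] by auto
  define M where "M = max M0 L"
  have "(2::real) ^ M0 \<le> 2 ^ M" by (simp add: M_def)
  then have M: "R \<le> 2 ^ M" using M0 by linarith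
  have "L \<le> M" by (simp add: M_def)
  then have "\<forall>\<zeta>\<in>cball 0 (\<rho> L). polynorm (xy_part (f \<zeta>)) \<le> 2 ^ L"
  proof (induction rule: inc_induct)
    case base
    have "\<rho> M \<le> 1/2" by (simp add: \<rho>_def)
    then have sub: "cball 0 (\<rho> M) \<subseteq> cball (0::complex) (1/2)" by (intro subset_cball)
    show ?case
    proof
      fix \<zeta> assume "\<zeta> \<in> cball (0::complex) (\<rho> M)"
      then have "polynorm (xy_part (f \<zeta>)) \<le> R"
        by (intro R subsetD[OF sub])
      then show "polynorm (xy_part (f \<zeta>)) \<le> 2 ^ M" using M by (rule order_trans)
    qed
  next
    case (step N)
    have pow_le: "(2::real) ^ L \<le> 2 ^ N" using step by simp
    have xy: "polynorm (xy_part (f 0)) \<le> norm (f 0)"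
      by (simp add: polynorm_le_iff xy_part_def Finite_Cartesian_Product.norm_nth_le)
    have card: "1 \<le> real CARD('n)" by (simp add: Suc_leI)
    have z: "norm (z_coord (f 0)) \<le> 1 * 2 ^ (3 * Suc N)"
    proof -
      have "norm (z_coord (f 0)) \<le> 2 ^ L"
        using f0 Finite_Cartesian_Product.norm_nth_le[of "f 0" "Inr ()"] by (simp add: z_coord_def)
      also have "\<dots> \<le> (2::real) ^ (3 * Suc N)"
        using step by (intro power_increasing) auto
      finally show ?thesis by simp
    qed
    also have "\<dots> \<le> real CARD('n) * 2 ^ (3 * Suc N)"
      using card by (intro mult_right_mono) auto
    finally have z: "norm (z_coord (f 0)) \<le> real CARD('n) * 2 ^ (3 * Suc N)" .
    have pos_\<rho>: "0 < \<rho> (Suc N)" "\<rho> (Suc N) < 1"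
    proof -
      have "1 < (2::real) ^ Suc N" by (rule one_less_power) auto
      then show "0 < \<rho> (Suc N)" by (simp add: \<rho>_def del: power_Suc)
      have "0 < 1 / (2::real) ^ Suc N" by (simp del: power_Suc)
      moreover have "(1 - x) / 2 < 1" if "0 < x" for x :: real using that by simp
      ultimately show "\<rho> (Suc N) < 1" unfolding \<rho>_def by blast
    qed
    have "\<rho> (Suc N) * (1 - 1 / 2 ^ Suc N) = \<rho> N + 1 / 2 * (1 / 2 ^ Suc N)\<^sup>2"
      by (simp add: \<rho>_def power2_eq_square field_simps)
    then have \<rho>_le: "\<rho> N \<le> \<rho> (Suc N) * (1 - 1 / 2 ^ Suc N)" by simp
    show ?case
    proof
      fix \<zeta> assume "\<zeta> \<in> cball (0::complex) (\<rho> N)"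
      then have 1: "\<zeta> \<in> cball 0 (\<rho> (Suc N) * (1 - 1 / 2 ^ Suc N))"
        by (rule subsetD[OF subset_cball[OF \<rho>_le]])
      have "polynorm (xy_part (f 0)) < 2 ^ N"
        using f0 xy pow_le by linarith
      then have 2: "polynorm (xy_part (f 0)) < 2 ^ (Suc N - 1)" by simp
      have "polynorm (xy_part (f \<zeta>)) < 2 ^ (Suc N - 1)"
        by (rule descend_one_level[OF pos C f _ 2 z pos_\<rho> bspec[OF step.IH] 1]) simp_all
      then show "polynorm (xy_part (f \<zeta>)) \<le> 2 ^ N" by simp
    qed
  qed
  moreover have "1 / 4 \<le> \<rho> L"
  proof -
    have "(2::real) ^ 1 \<le> 2 ^ L" using L by (intro power_increasing) auto
    then have "1 / (2::real) ^ L \<le> 1 / 2" by (simp add: field_simps)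
    then show ?thesis by (simp add: \<rho>_def)
  qed
  ultimately show ?thesis using \<zeta> by simp
qed

text \<open>A disk centred in the ball of radius \<open>2 ^ L\<close> is confined on the disk of radius \<open>1/4\<close>, so Cauchy's
  estimate and the contact equation bound all components of its derivative at the centre by \<open>A\<close>.
  If this derivative is \<open>\<lambda> v\<close>, then \<open>1 / \<bar>\<lambda>\<bar>\<close> is at least a fixed multiple of \<open>\<bar>v\<bar>\<close>.\<close>

lemma kobayashi_norm_lower_bound:
  fixes C :: "nat \<Rightarrow> real"
  assumes pos: "\<And>N. N \<ge> 1 \<Longrightarrow> C N > 0"
    and C: "\<And>N. N \<ge> 1 \<Longrightarrow> C N \<ge> real CARD('n::finite) * 2 ^ (3 * N + 1)"
    and L: "L \<ge> 1"
  obtains c where "c > 0"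
    "\<And>(p :: 'n contact_space) v. norm p < 2 ^ L \<Longrightarrow>
       ennreal (c * norm v) \<le> kobayashi_norm (Omega0 C) (\<lambda>p. {v. alpha0 p v = 0}) p v"
proof -
  define n where "n = real CARD('n)"
  define A where "A = n * (2 ^ L)\<^sup>2 / (1/4)"
  define D where "D = real CARD(('n + 'n) + unit) * A"
  have n: "1 \<le> n" by (simp add: n_def Suc_leI)
  have "A > 0" "D > 0" using n by (auto simp: A_def D_def)
  have A1: "2 ^ L / (1/4) \<le> A"
  proof -
    have "1 * (2 ^ L * 1) \<le> n * (2 ^ L * (2::real) ^ L)"
      using n by (intro mult_mono) auto
    then show ?thesis by (simp add: A_def power2_eq_square)
  qed
  have "ennreal (1 / D * norm v) \<le> ennreal (1 / norm c)"
    if p: "norm p < 2 ^ L" and "c \<noteq> 0" and f: "horizontal_disk (Omega0 C) (\<lambda>p. {v. alpha0 p v = 0}) f"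
      and "f 0 = p" and df: "disk_deriv f 0 = c *s v"
    for p v :: "'n contact_space" and c f
  proof -
    have conf: "polynorm (xy_part (f \<zeta>)) \<le> 2 ^ L" if "\<zeta> \<in> cball 0 (1/4)" for \<zeta>
      using confinement[OF pos C f L _ that] p \<open>f 0 = p\<close> by simp
    have "norm (disk_deriv f 0 $ i) \<le> A" for i
    proof (cases i)
      case (Inl k)
      have "norm (deriv (\<lambda>w. f w $ Inl k) 0) \<le> 2 ^ L / (1/4)"
      proof (rule deriv_bound_cball[where \<rho> = "1/4"])
        show "norm (f \<zeta> $ Inl k) \<le> 2 ^ L" if "\<zeta> \<in> cball 0 (1/4)" for \<zeta>
          using conf[OF that] norm_nth_le_polynorm[of "xy_part (f \<zeta>)" k] by (simp add: xy_part_def)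
      qed (use f in \<open>auto simp: horizontal_disk_def\<close>)
      then show ?thesis using A1 Inl by (simp add: disk_deriv_def)
    next
      case (Inr k)
      then show ?thesis
        using horizontal_disk_z_deriv_bound[OF f conf, of "1/4" "1/4" 0]
        by (simp add: disk_deriv_def z_coord_def A_def n_def)
    qed
    then have "(\<Sum>i\<in>UNIV. norm (disk_deriv f 0 $ i)) \<le> D"
      unfolding D_def by (metis (mono_tags, lifting) sum_bounded_above)
    then have "norm (disk_deriv f 0) \<le> D"
      using L2_set_le_sum[of UNIV "\<lambda>i. norm (disk_deriv f 0 $ i)"] by (simp add: norm_vec_def)
    moreover have "norm (c *s v) = norm c * norm v"
      by (simp add: norm_vec_def norm_mult L2_set_right_distrib)
    ultimately have "norm c * norm v \<le> D" by (simp add: df)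
    then show ?thesis
      using \<open>D > 0\<close> \<open>c \<noteq> 0\<close> by (intro ennreal_leI) (simp add: field_simps)
  qed
  then show ?thesis
    using \<open>D > 0\<close> by (intro that[of "1 / D"]) (auto simp: kobayashi_norm_def intro!: Inf_greatest)
qed

section \<open>Lengths of piecewise smooth paths\<close>

text \<open>The speed enters through a Borel function \<open>g\<close> below it because the speed of a path that is only
  piecewise smooth is awkward to prove measurable, while the integral of nonmeasurable functions
  is not additive. Taking \<open>g\<close> to vanish outside the open interval makes it possible to add the
  functions of adjacent arcs, and to ignore the one-sided derivatives at the end points.\<close>

lemma smooth_arc_speed:
  fixes \<gamma> :: "real \<Rightarrow> 'a::euclidean_space"
  assumes ab: "0 \<le> a" "a < b" "b \<le> 1" and smooth: "smooth_on_interval a b \<gamma>"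
  shows "\<exists>g\<in>borel_measurable borel.
    (\<forall>t. g t \<le> ennreal (norm (vector_derivative \<gamma> (at t within {0..1}))) * indicator {a<..<b} t) \<and>
    ennreal (norm (\<gamma> b - \<gamma> a)) \<le> (\<integral>\<^sup>+ t. g t \<partial>lborel)"
proof -
  obtain D where D0: "\<And>t. t \<in> {a..b} \<Longrightarrow> D (0::nat) t = \<gamma> t"
    and D: "\<And>k t. t \<in> {a..b} \<Longrightarrow> (D k has_vector_derivative D (Suc k) t) (at t within {a..b})"
    using smooth unfolding smooth_on_interval_def by blast
  let ?g = "\<lambda>t. ennreal (indicator {a<..<b} t *\<^sub>R norm (D 1 t))"
  have cont: "continuous_on {a..b} (\<lambda>t. norm (D 1 t))"
    using D[of _ 1] by (intro continuous_on_norm continuous_on_vector_derivative[where f' = "D 2"]) (simp add: numeral_2_eq_2)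
  have ftc: "(D 1 has_integral \<gamma> b - \<gamma> a) {a..b}"
    using fundamental_theorem_of_calculus[of a b "D 0" "D 1"] D[of _ 0] D0 ab by simp
  define I where "I = integral {a..b} (\<lambda>t. norm (D 1 t))"
  have I: "((\<lambda>t. norm (D 1 t)) has_integral I) {a..b}"
    unfolding I_def using cont by (intro integrable_integral integrable_continuous_real)
  have len: "norm (\<gamma> b - \<gamma> a) \<le> I"
    using integral_norm_bound_integral[of "D 1" "{a..b}" "\<lambda>t. norm (D 1 t)"] ftc I
    by (simp add: I_def has_integral_iff)
  have "(\<integral>\<^sup>+ t. ?g t \<partial>lborel) = ennreal I"
    using nn_integral_has_integral_lebesgue[of "{a<..<b}" "\<lambda>t. norm (D 1 t)" I] I
    by (simp add: has_integral_Icc_iff_Ioo)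
  moreover have "?g \<in> borel_measurable borel"
    by (intro measurable_compose[OF _ measurable_ennreal] borel_measurable_continuous_on_indicator
        continuous_on_subset[OF cont]) auto
  moreover have "?g t \<le> ennreal (norm (vector_derivative \<gamma> (at t within {0..1}))) * indicator {a<..<b} t" for t
  proof (cases "t \<in> {a<..<b}")
    case True
    then have "(D 0 has_vector_derivative D 1 t) (at t)"
      using D[of t 0] at_within_interior[of t "{a..b}"] by auto
    then have "(\<gamma> has_vector_derivative D 1 t) (at t)"
      by (rule has_vector_derivative_transform_within_open[of _ _ _ "{a<..<b}"]) (use True D0 in auto)
    then have "vector_derivative \<gamma> (at t within {0..1}) = D 1 t"
      by (rule vector_derivative_at_within_ivl) (use True ab in auto)
    then show ?thesis using True by simp
  qed simp
  ultimately show ?thesis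
    using len by (intro bexI[of _ ?g]) (auto intro: ennreal_leI)
qed

text \<open>Induction on the number of break points inside the interval: the path is cut at one of them, and
  the two functions are added.\<close>

lemma piecewise_smooth_speed:
  fixes \<gamma> :: "real \<Rightarrow> 'a::euclidean_space"
  assumes "finite S"
    and smooth: "\<And>a b. 0 \<le> a \<Longrightarrow> a < b \<Longrightarrow> b \<le> 1 \<Longrightarrow> {a<..<b} \<inter> S = {} \<Longrightarrow> smooth_on_interval a b \<gamma>"
    and "0 \<le> a" "a \<le> b" "b \<le> 1"
  shows "\<exists>g\<in>borel_measurable borel.
    (\<forall>t. g t \<le> ennreal (norm (vector_derivative \<gamma> (at t within {0..1}))) * indicator {a<..<b} t) \<and>
    ennreal (norm (\<gamma> b - \<gamma> a)) \<le> (\<integral>\<^sup>+ t. g t \<partial>lborel)"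
  using assms(3-5)
proof (induction "card ({a<..<b} \<inter> S)" arbitrary: a b rule: less_induct)
  case less
  let ?v = "\<lambda>t. ennreal (norm (vector_derivative \<gamma> (at t within {0..1})))"
  consider "a = b" | "a < b" "{a<..<b} \<inter> S = {}" | s where "s \<in> {a<..<b} \<inter> S"
    using less.prems by fastforce
  then show ?case
  proof cases
    case 1
    then show ?thesis by (intro bexI[of _ "\<lambda>_. 0"]) auto
  next
    case 2
    then show ?thesis using less.prems by (intro smooth_arc_speed smooth) auto
  next
    case 3
    have "card ({a<..<s} \<inter> S) < card ({a<..<b} \<inter> S)" "card ({s<..<b} \<inter> S) < card ({a<..<b} \<inter> S)"
      using 3 \<open>finite S\<close> by (auto intro!: psubset_card_mono)
    note IH = less.hyps[OF this(1)] less.hyps[OF this(2)]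
    have s: "0 \<le> a" "a \<le> s" "s \<le> 1" "0 \<le> s" "s \<le> b" "b \<le> 1"
      using less.prems 3 by auto
    obtain g where g: "g \<in> borel_measurable borel" "\<And>t. g t \<le> ?v t * indicator {a<..<s} t"
        "ennreal (norm (\<gamma> s - \<gamma> a)) \<le> (\<integral>\<^sup>+ t. g t \<partial>lborel)"
      using IH(1)[OF s(1-3)] by blast
    obtain h where h: "h \<in> borel_measurable borel" "\<And>t. h t \<le> ?v t * indicator {s<..<b} t"
        "ennreal (norm (\<gamma> b - \<gamma> s)) \<le> (\<integral>\<^sup>+ t. h t \<partial>lborel)"
      using IH(2)[OF s(4-6)] by blast
    have "g t + h t \<le> ?v t * indicator {a<..<b} t" for t
    proof -
      have "g t + h t \<le> ?v t * (indicator {a<..<s} t + indicator {s<..<b} t)"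
        using add_mono[OF g(2)[of t] h(2)[of t]] by (simp add: distrib_left)
      also have "\<dots> \<le> ?v t * indicator {a<..<b} t"
        using 3 by (intro mult_left_mono) (auto simp: indicator_def)
      finally show ?thesis .
    qed
    moreover have "ennreal (norm (\<gamma> b - \<gamma> a)) \<le> (\<integral>\<^sup>+ t. g t + h t \<partial>lborel)"
    proof -
      have "ennreal (norm (\<gamma> b - \<gamma> a)) \<le> ennreal (norm (\<gamma> s - \<gamma> a)) + ennreal (norm (\<gamma> b - \<gamma> s))"
        using norm_triangle_ineq[of "\<gamma> s - \<gamma> a" "\<gamma> b - \<gamma> s"] by (simp flip: ennreal_plus)
      also have "\<dots> \<le> (\<integral>\<^sup>+ t. g t \<partial>lborel) + (\<integral>\<^sup>+ t. h t \<partial>lborel)"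
        by (intro add_mono g h)
      also have "\<dots> = (\<integral>\<^sup>+ t. g t + h t \<partial>lborel)"
        using g h by (intro nn_integral_add[symmetric]) auto
      finally show ?thesis .
    qed
    ultimately show ?thesis
      using g h by (intro bexI[of _ "\<lambda>t. g t + h t"]) auto
  qed
qed

lemma first_exit_time:
  fixes \<gamma> :: "real \<Rightarrow> 'a::real_normed_vector"
  assumes "path \<gamma>"
  obtains T where "0 \<le> T" "T \<le> 1" "norm (pathfinish \<gamma> - pathstart \<gamma>) \<le> norm (\<gamma> T - pathstart \<gamma>)"
    "\<And>t. 0 \<le> t \<Longrightarrow> t < T \<Longrightarrow> norm (\<gamma> t - pathstart \<gamma>) < norm (pathfinish \<gamma> - pathstart \<gamma>)"
proof -
  let ?A = "{t \<in> {0..1}. norm (pathfinish \<gamma> - pathstart \<gamma>) \<le> norm (\<gamma> t - pathstart \<gamma>)}"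
  have "closed ?A"
    using assms by (intro continuous_on_closed_Collect_le continuous_intros) (auto simp: path_def)
  then have "compact ({0..1} \<inter> ?A)" by (intro compact_Int_closed) auto
  moreover have "1 \<in> {0..1} \<inter> ?A" by (simp add: pathfinish_def)
  ultimately obtain T where T: "T \<in> {0..1} \<inter> ?A" "\<And>t. t \<in> {0..1} \<inter> ?A \<Longrightarrow> T \<le> t"
    using compact_attains_inf[of "{0..1} \<inter> ?A"] by blast
  show ?thesis
  proof (rule that[of T])
    fix t assume t: "0 \<le> t" "t < T"
    then have "t \<in> {0..1}" using T(1) by simp
    then show "norm (\<gamma> t - pathstart \<gamma>) < norm (pathfinish \<gamma> - pathstart \<gamma>)"
      using T(2)[of t] t by (intro not_le_imp_less notI) simp
  qed (use T(1) in auto)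
qed

text \<open>Up to the first time at which a path from \<open>p\<close> to \<open>q\<close> has distance \<open>\<delta> = \<bar>q - p\<bar>\<close> from \<open>p\<close>, it
  stays in a fixed ball about the origin, on which the Kobayashi norm dominates \<open>c\<close> times the
  Euclidean norm. So its length is at least \<open>c \<delta>\<close>, with \<open>c\<close> independent of the path.\<close>

lemma hyperbolic_of_local_bound:
  fixes M :: "(complex ^ 'm::finite) set"
  assumes bound: "\<And>R. \<exists>c>0. \<forall>p v. norm p < R \<longrightarrow> ennreal (c * norm v) \<le> kobayashi_norm M \<xi> p v"
  shows "directed_hyperbolic M \<xi>"
  unfolding directed_hyperbolic_def
proof (intro ballI impI)
  fix p q :: "complex ^ 'm" assume "p \<noteq> q"
  define \<delta> where "\<delta> = norm (q - p)"
  have "\<delta> > 0" using \<open>p \<noteq> q\<close> by (simp add: \<delta>_def)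
  obtain c where "c > 0" and c: "\<And>x v. norm x < norm p + \<delta> \<Longrightarrow> ennreal (c * norm v) \<le> kobayashi_norm M \<xi> x v"
    using bound by blast
  have "ennreal (c * \<delta>) \<le> (\<integral>\<^sup>+ t\<in>{0..1}. kobayashi_norm M \<xi> (\<gamma> t) (vector_derivative \<gamma> (at t within {0..1})) \<partial>lborel)"
    if \<gamma>: "horizontal_path M \<xi> \<gamma>" and pq: "pathstart \<gamma> = p" "pathfinish \<gamma> = q" for \<gamma>
  proof -
    let ?v = "\<lambda>t. vector_derivative \<gamma> (at t within {0..1})"
    have "path \<gamma>" using \<gamma> by (simp add: horizontal_path_def piecewise_smooth_path_def)
    then obtain T where T: "0 \<le> T" "T \<le> 1" "\<delta> \<le> norm (\<gamma> T - p)"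
      and before: "\<And>t. 0 \<le> t \<Longrightarrow> t < T \<Longrightarrow> norm (\<gamma> t - p) < \<delta>"
      using first_exit_time[OF \<open>path \<gamma>\<close>] unfolding \<delta>_def pq by blast
    have "piecewise_smooth_path \<gamma>" using \<gamma> by (simp add: horizontal_path_def)
    then obtain S where "finite S"
      and "\<forall>a b. 0 \<le> a \<and> a < b \<and> b \<le> 1 \<and> {a<..<b} \<inter> S = {} \<longrightarrow> smooth_on_interval a b \<gamma>"
      unfolding piecewise_smooth_path_def by (elim conjE exE)
    then have S: "smooth_on_interval a b \<gamma>" if "0 \<le> a" "a < b" "b \<le> 1" "{a<..<b} \<inter> S = {}" for a b
      using that by simp
    note speed = piecewise_smooth_speed[OF \<open>finite S\<close> S order_refl T(1,2)]
    obtain g where g: "g \<in> borel_measurable borel" "\<And>t. g t \<le> ennreal (norm (?v t)) * indicator {0<..<T} t"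
      "ennreal (norm (\<gamma> T - \<gamma> 0)) \<le> (\<integral>\<^sup>+ t. g t \<partial>lborel)"
      using speed by blast
    have pointwise: "ennreal c * g t \<le> kobayashi_norm M \<xi> (\<gamma> t) (?v t) * indicator {0..1} t" for t
    proof (cases "t \<in> {0<..<T}")
      case True
      have "norm (\<gamma> t) < norm p + \<delta>"
        using before[of t] True norm_triangle_sub[of "\<gamma> t" p] by auto
      then have "ennreal (c * norm (?v t)) \<le> kobayashi_norm M \<xi> (\<gamma> t) (?v t)"
        by (rule c)
      moreover have "ennreal c * g t \<le> ennreal c * ennreal (norm (?v t))"
        using g(2)[of t] True by (intro mult_left_mono) auto
      ultimately show ?thesis
        using True T \<open>c > 0\<close> by (simp add: ennreal_mult)
    next
      case False
      then show ?thesis using g(2)[of t] by simp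
    qed
    have "ennreal (c * \<delta>) \<le> ennreal c * ennreal (norm (\<gamma> T - \<gamma> 0))"
      using T pq \<open>c > 0\<close> by (auto simp: pathstart_def simp flip: ennreal_mult intro!: ennreal_leI)
    also have "\<dots> \<le> ennreal c * (\<integral>\<^sup>+ t. g t \<partial>lborel)"
      by (intro mult_left_mono g) simp
    also have "\<dots> = (\<integral>\<^sup>+ t. ennreal c * g t \<partial>lborel)"
      using g by (intro nn_integral_cmult[symmetric]) simp
    also have "\<dots> \<le> (\<integral>\<^sup>+ t\<in>{0..1}. kobayashi_norm M \<xi> (\<gamma> t) (?v t) \<partial>lborel)"
      by (intro nn_integral_mono pointwise)
    finally show ?thesis .
  qed
  then have "ennreal (c * \<delta>) \<le> kobayashi_dist M \<xi> p q"
    unfolding kobayashi_dist_def by (intro Inf_greatest) blast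
  moreover have "0 < ennreal (c * \<delta>)" using \<open>c > 0\<close> \<open>\<delta> > 0\<close> by simp
  ultimately show "0 < kobayashi_dist M \<xi> p q" by order
qed

section \<open>The hyperbolic domain\<close>

theorem proposition1p3:
  fixes C :: "nat \<Rightarrow> real"
  assumes "\<And>N. N \<ge> 1 \<Longrightarrow> C N > 0"
    and "\<And>N. N \<ge> 1 \<Longrightarrow> C N \<ge> real CARD('n::finite) * 2 ^ (3 * N + 1)"
  shows "open (Omega0 C :: 'n contact_space set)
       \<and> connected (Omega0 C :: 'n contact_space set)
       \<and> alpha0_hyperbolic (Omega0 C :: 'n contact_space set)"
proof (intro conjI)
  show "open (Omega0 C :: 'n contact_space set)" by (rule open_Omega0[OF assms(1)])
  show "connected (Omega0 C :: 'n contact_space set)" by (rule connected_Omega0[OF assms(1)])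
  show "alpha0_hyperbolic (Omega0 C :: 'n contact_space set)"
    unfolding alpha0_hyperbolic_def
  proof (rule hyperbolic_of_local_bound)
    fix R :: real
    obtain k where k: "R < 2 ^ k" using real_arch_pow[of 2 R] by auto
    define L where "L = max k 1"
    have "(2::real) ^ k \<le> 2 ^ L" unfolding L_def by (intro power_increasing) auto
    then have R: "R < 2 ^ L" using k by linarith
    have "L \<ge> 1" by (simp add: L_def)
    then obtain c where "c > 0" and c: "\<And>(p :: 'n contact_space) v. norm p < 2 ^ L \<Longrightarrow>
        ennreal (c * norm v) \<le> kobayashi_norm (Omega0 C) (\<lambda>p. {v. alpha0 p v = 0}) p v"
      using kobayashi_norm_lower_bound[OF assms] by blast
    show "\<exists>c>0. \<forall>(p :: 'n contact_space) v. norm p < R \<longrightarrow>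
        ennreal (c * norm v) \<le> kobayashi_norm (Omega0 C) (\<lambda>p. {v. alpha0 p v = 0}) p v"
      using \<open>c > 0\<close> c[OF less_trans[OF _ R]] by (intro exI[of _ c]) simp
  qed
qed

end
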